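(* Let $A\in\mathbb{R}^{n\times n}$, $B\in\mathbb{R}^{n\times m}$ with $(A,B)$ controllable and $B$ of full column rank, let $T>0$ and let $K(t)$, $t\in[0,T]$, be a feedback matrix. Suppose $\bar Q\in\partial\,\mathbb{S}_+^n$ is a feasible solution of the inverse LQ problem for $K$, i.e. $\bar Q\in\mathcal{D}_{K+}$. Let $\{\Delta Q_1,\dots,\Delta Q_r\}$ be a basis of the subspace $\mathcal{S}$. Let $X^*$ be a non-zero optimal solution of $$\min_{X}\ \mathrm{tr}(\bar QX)\quad\text{s.t.}\quad \mathrm{tr}(\Delta Q_iX)=0\ (i=1,\dots,r),\quad X\in\mathbb{S}^n,\ X\succeq 0,$$ written as $X^*=V\,\mathrm{diag}(\lambda_1,\dots,\lambda_l,0,\dots,0)V^T$ with $V$ a (real) unitary matrix and $l=\mathrm{rank}(X^* )$. Define $$\mathcal{T}=\left\{V\begin{bmatrix}0&0\\0&W\end{bmatrix}V^T : W\in\mathbb{S}^{n-l}\right\}.$$ If $\mathcal{T}\cap\mathcal{S}=\{0\}$, then $\bar Q$ is the unique solution of the inverse LQ problem, i.e. $\mathcal{D}_{K+}=\{\bar Q\}$.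
   Context: $\mathbb{S}^n$ is the space of real symmetric $n\times n$ matrices, $\mathbb{S}_+^n$ the positive semidefinite cone and $\partial\,\mathbb{S}_+^n$ its boundary (singular positive semidefinite matrices). For $Q,F\in\mathbb{S}_+^n$ let $P(t)$ be the solution on $[0,T]$ of the differential Riccati equation $-\dot P=PA+A^TP-PBB^TP+Q$, $P(T)=F$. The finite-horizon LQ problem of minimizing $x^T(T)Fx(T)+\int_0^T(x^TQx+u^Tu)\,dt$ subject to $\dot x=Ax+Bu$, $x(0)=x_0$, has optimal feedback $u=K(t)x$ with $K(t)=-B^TP(t)$; write $K=\mathrm{DRE}\{Q,F\}$ in this case. Let $$\mathcal{D}_{K+}=\{Q\in\mathbb{S}_+^n : K=\mathrm{DRE}\{Q,F\}\text{ for some }F\in\mathbb{S}_+^n\},$$ $$\mathcal{S}=\{\Delta Q\in\mathbb{S}^n:\ \exists\,\Delta P\in\mathbb{S}^n\text{ with }A^T\Delta P+\Delta P A+\Delta Q=0,\ B^T\Delta P=0\}.$$ *)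

theory Defs
  imports "HOL-Analysis.Analysis"
begin

section \<open>Symmetric and positive semidefinite matrices\<close>

definition sym_matrices :: "(real^'n^'n) set" where
  "sym_matrices = {M. transpose M = M}"

definition psd_cone :: "(real^'n^'n) set" where
  "psd_cone = {M \<in> sym_matrices. \<forall>x. 0 \<le> x \<bullet> (M *v x)}"

text \<open>The boundary is taken in the space of symmetric matrices: as a subset of all square
  matrices the cone has empty interior when \<open>n > 1\<close>.\<close>

definition psd_boundary :: "(real^'n^'n) set" where
  "psd_boundary = top_of_set sym_matrices frontier_of psd_cone"

lemma psd_null_vector:
  fixes M :: "real^'n^'n"
  assumes M: "M \<in> psd_cone" and x: "x \<bullet> (M *v x) = 0"
  shows "M *v x = 0"
proof (rule ccontr)
  assume "M *v x \<noteq> 0"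
  define y where "y = M *v x"
  define a where "a = y \<bullet> y"
  define b where "b = y \<bullet> (M *v y)"
  have a: "a > 0" using \<open>M *v x \<noteq> 0\<close> by (simp add: a_def y_def)
  have tr: "transpose M = M" and pos: "\<And>z. 0 \<le> z \<bullet> (M *v z)"
    using M by (auto simp: psd_cone_def sym_matrices_def)
  have xMy: "x \<bullet> (M *v y) = a"
    by (metis a_def y_def tr dot_lmul_matrix vector_transpose_matrix)
  have b: "b \<ge> 0" using pos by (simp add: b_def)
  define t where "t = - a / (b + 1)"
  have "(x + t *\<^sub>R y) \<bullet> (M *v (x + t *\<^sub>R y)) = 2 * t * a + t\<^sup>2 * b"
    using x xMy
    by (simp add: matrix_vector_right_distrib inner_add_left inner_add_right a_def b_def
        matrix_vector_mult_scaleR y_def[symmetric] algebra_simps power2_eq_square)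
  with pos have ge: "0 \<le> 2 * t * a + t\<^sup>2 * b" by metis
  define c where "c = b + 1"
  have c: "c > 0" "b = c - 1" "t = - a / c" using b by (auto simp: c_def t_def)
  have "2 * t * a + t\<^sup>2 * b = - (a\<^sup>2 * (c + 1) / c\<^sup>2)"
    using c(1) unfolding c(2,3) by (simp add: field_simps power2_eq_square)
  moreover have "0 < a\<^sup>2 * (c + 1) / c\<^sup>2" using a c(1) by simp
  ultimately show False using ge by linarith
qed

lemma psd_boundary_eq_singular:
  "psd_boundary = {M \<in> psd_cone. \<not> invertible (M :: real^'n^'n)}"
proof -
  have cont: "continuous_on UNIV (\<lambda>M :: real^'n^'n. M *v x)" for x
    unfolding matrix_vector_mult_def by (intro continuous_intros)
  have "closed {M :: real^'n^'n. \<forall>x. 0 \<le> x \<bullet> (M *v x)}"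
    by (intro closed_Collect_all closed_Collect_le continuous_intros cont)
  then have "closedin (top_of_set sym_matrices) (psd_cone :: (real^'n^'n) set)"
    by (simp add: closedin_closed_Int psd_cone_def Collect_conj_eq)
  then have cl: "top_of_set sym_matrices closure_of psd_cone = (psd_cone :: (real^'n^'n) set)"
    by (rule closure_of_closedin)
  have "(M \<in> top_of_set sym_matrices interior_of psd_cone) \<longleftrightarrow> invertible M"
    if M: "M \<in> psd_cone" for M :: "real^'n^'n"
  proof
    assume "M \<in> top_of_set sym_matrices interior_of psd_cone"
    then obtain U where U: "open U" "M \<in> U" "sym_matrices \<inter> U \<subseteq> psd_cone"
      by (auto simp: interior_of_def openin_open)
    have "x = 0" if "M *v x = 0" for x
    proof (rule ccontr)
      assume "x \<noteq> 0"
      have "((\<lambda>t. M - t *\<^sub>R mat 1) \<longlongrightarrow> M - 0 *\<^sub>R mat 1) (at_right (0::real))"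
        by (intro tendsto_intros)
      then have "eventually (\<lambda>t. M - t *\<^sub>R mat 1 \<in> U) (at_right (0::real))"
        using U by (auto dest: topological_tendstoD)
      then have "eventually (\<lambda>t. t > 0 \<and> M - t *\<^sub>R mat 1 \<in> U) (at_right (0::real))"
        using eventually_at_right_less[of "0::real"] by eventually_elim simp
      then obtain t :: real where t: "t > 0" "M - t *\<^sub>R mat 1 \<in> U"
        using eventually_happens'[OF trivial_limit_at_right_real] by blast
      have "M - t *\<^sub>R mat 1 \<in> sym_matrices"
        using M by (auto simp: psd_cone_def sym_matrices_def transpose_def mat_def vec_eq_iff)
      with t U have "M - t *\<^sub>R mat 1 \<in> psd_cone" by blast
      then have "0 \<le> x \<bullet> ((M - t *\<^sub>R mat 1) *v x)" by (simp add: psd_cone_def)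
      also have "\<dots> = - (t * (x \<bullet> x))"
        using that by (simp add: matrix_vector_mult_diff_rdistrib inner_diff_right
            scaleR_matrix_vector_assoc[symmetric])
      finally have "t * (x \<bullet> x) \<le> 0" by simp
      moreover have "0 < t * (x \<bullet> x)" using t \<open>x \<noteq> 0\<close> by simp
      ultimately show False by linarith
    qed
    then show "invertible M"
      by (metis invertible_left_inverse matrix_left_invertible_ker)
  next
    assume inv: "invertible M"
    define S where "S = sphere (0 :: real^'n) 1"
    have inj: "M *v x = 0 \<Longrightarrow> x = 0" for x
      using inv by (metis invertible_left_inverse matrix_left_invertible_ker)
    have pos: "0 < x \<bullet> (M *v x)" if "x \<noteq> 0" for x
      using M that psd_null_vector[OF M] inj by (fastforce simp: psd_cone_def less_le)
    have "compact S" "S \<noteq> {}" by (auto simp: S_def)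
    moreover have "continuous_on S (\<lambda>x. x \<bullet> (M *v x))"
      by (intro continuous_intros matrix_vector_mult_linear_continuous_on)
    ultimately obtain x0 where x0: "x0 \<in> S" "\<And>x. x \<in> S \<Longrightarrow> x0 \<bullet> (M *v x0) \<le> x \<bullet> (M *v x)"
      by (metis continuous_attains_inf)
    define d where "d = x0 \<bullet> (M *v x0)"
    have d: "d > 0" using x0 by (auto simp: d_def S_def intro!: pos)
    have "bounded_bilinear ((*v) :: real^'n^'n \<Rightarrow> real^'n \<Rightarrow> real^'n)"
      unfolding bilinear_conv_bounded_bilinear[symmetric] bilinear_def
      by (auto intro!: linearI simp: matrix_vector_right_distrib matrix_vector_mult_scaleR
          matrix_vector_mult_add_rdistrib scaleR_matrix_vector_assoc)
    then obtain C where C: "C > 0" "\<And>N x. norm ((N :: real^'n^'n) *v x) \<le> norm N * norm x * C"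
      using bounded_bilinear.pos_bounded by blast
    have "N \<in> psd_cone" if N: "N \<in> sym_matrices" "N \<in> ball M (d / C)" for N
    proof -
      have on_S: "0 \<le> x \<bullet> (N *v x)" if x: "x \<in> S" for x
      proof -
        have "\<bar>x \<bullet> ((N - M) *v x)\<bar> \<le> norm x * norm ((N - M) *v x)"
          by (rule Cauchy_Schwarz_ineq2)
        also have "\<dots> \<le> norm (N - M) * C" using C(2)[of "N - M" x] x by (simp add: S_def)
        also have "\<dots> \<le> d"
          using N(2) C(1) by (simp add: dist_norm norm_minus_commute field_simps)
        finally show ?thesis
          using x0(2)[OF x] by (simp add: matrix_vector_mult_diff_rdistrib inner_diff_right d_def)
      qed
      have "0 \<le> x \<bullet> (N *v x)" for x
      proof (cases "x = 0")
        case False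
        define y where "y = (1 / norm x) *\<^sub>R x"
        have "y \<in> S" using False by (simp add: y_def S_def)
        from on_S[OF this] have "0 \<le> y \<bullet> (N *v y)" .
        moreover have "x = norm x *\<^sub>R y" using False by (simp add: y_def)
        ultimately show ?thesis
          by (metis (no_types, lifting) inner_scaleR_left inner_scaleR_right
              matrix_vector_mult_scaleR mult_nonneg_nonneg norm_ge_zero)
      qed simp
      then show ?thesis using N(1) by (simp add: psd_cone_def)
    qed
    then have "sym_matrices \<inter> ball M (d / C) \<subseteq> psd_cone" by blast
    moreover have "openin (top_of_set sym_matrices) (sym_matrices \<inter> ball M (d / C))"
      by (simp add: openin_open_Int)
    moreover have "M \<in> sym_matrices \<inter> ball M (d / C)"
      using M C(1) d by (simp add: psd_cone_def)
    ultimately show "M \<in> top_of_set sym_matrices interior_of psd_cone"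
      unfolding interior_of_def by blast
  qed
  then show ?thesis
    by (auto simp: psd_boundary_def frontier_of_def cl)
qed

section \<open>Controllability\<close>

text \<open>Every state can be steered to every other state in finite time. For a constant pair it
  makes no difference whether the controls are required to be continuous or only integrable, nor
  whether the horizon may depend on the two states.\<close>

definition controllable :: "real^'n^'n \<Rightarrow> real^'m^'n \<Rightarrow> bool" where
  "controllable A B \<longleftrightarrow>
     (\<forall>x0 x1. \<exists>\<tau>>0. \<exists>(u :: real \<Rightarrow> real^'m) (x :: real \<Rightarrow> real^'n).
        continuous_on {0..\<tau>} u \<and>
        (\<forall>t\<in>{0..\<tau>}. (x has_vector_derivative (A *v x t + B *v u t)) (at t within {0..\<tau>})) \<and>
        x 0 = x0 \<and> x \<tau> = x1)"

section \<open>The inverse LQ problem\<close>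

text \<open>One-sided derivatives are taken at the end points of the horizon.\<close>

definition riccati_solution ::
  "real^'n^'n \<Rightarrow> real^'m^'n \<Rightarrow> real \<Rightarrow> real^'n^'n \<Rightarrow> real^'n^'n \<Rightarrow> (real \<Rightarrow> real^'n^'n) \<Rightarrow> bool" where
  "riccati_solution A B T Q F P \<longleftrightarrow>
     (\<forall>t\<in>{0..T}. (P has_vector_derivative
          - (P t ** A + transpose A ** P t - P t ** B ** transpose B ** P t + Q))
        (at t within {0..T})) \<and>
     P T = F"

text \<open>\<open>is_DRE A B T Q F K\<close> says \<open>K = DRE{Q, F}\<close> on the horizon \<open>[0, T]\<close>. The right-hand side of
  the Riccati equation is locally Lipschitz, so there is at most one \<open>P\<close> and the existential
  quantifier speaks about the solution; values of \<open>K\<close> off the horizon are irrelevant.\<close>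

definition is_DRE ::
  "real^'n^'n \<Rightarrow> real^'m^'n \<Rightarrow> real \<Rightarrow> real^'n^'n \<Rightarrow> real^'n^'n \<Rightarrow> (real \<Rightarrow> real^'n^'m) \<Rightarrow> bool" where
  "is_DRE A B T Q F K \<longleftrightarrow>
     (\<exists>P. riccati_solution A B T Q F P \<and> (\<forall>t\<in>{0..T}. K t = - (transpose B ** P t)))"

definition inverse_LQ_solutions ::
  "real^'n^'n \<Rightarrow> real^'m^'n \<Rightarrow> real \<Rightarrow> (real \<Rightarrow> real^'n^'m) \<Rightarrow> (real^'n^'n) set" where
  "inverse_LQ_solutions A B T K = {Q \<in> psd_cone. \<exists>F\<in>psd_cone. is_DRE A B T Q F K}"

definition S_space :: "real^'n^'n \<Rightarrow> real^'m^'n \<Rightarrow> (real^'n^'n) set" where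
  "S_space A B = {dQ \<in> sym_matrices. \<exists>dP\<in>sym_matrices.
     transpose A ** dP + dP ** A + dQ = 0 \<and> transpose B ** dP = 0}"

section \<open>Block matrices\<close>

text \<open>The index type carries no order, so positions \<open>1, \<dots>, n\<close> of rows and columns are given by an
  enumeration \<open>e\<close>, a bijection from the index type onto \<open>{1..n}\<close>. Matrices whose size is not a
  type, such as \<open>W\<close>, are functions of two positions.\<close>

definition leading_diag :: "('n \<Rightarrow> nat) \<Rightarrow> nat \<Rightarrow> (nat \<Rightarrow> real) \<Rightarrow> real^'n^'n" where
  "leading_diag e l ev = (\<chi> i j. if i = j \<and> e i \<le> l then ev (e i) else 0)"

definition trailing_block :: "('n \<Rightarrow> nat) \<Rightarrow> nat \<Rightarrow> (nat \<Rightarrow> nat \<Rightarrow> real) \<Rightarrow> real^'n^'n" where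
  "trailing_block e l W = (\<chi> i j. if l < e i \<and> l < e j then W (e i - l) (e j - l) else 0)"

definition T_space :: "('n \<Rightarrow> nat) \<Rightarrow> nat \<Rightarrow> real^'n^'n \<Rightarrow> (real^'n^'n) set" where
  "T_space e l V = {V ** trailing_block e l W ** transpose V | W.
     \<forall>p\<in>{1..CARD('n) - l}. \<forall>q\<in>{1..CARD('n) - l}. W p q = W q p}"

end

theory Submission
  imports Defs
begin

text \<open>Let \<open>Q\<close> and \<open>Qbar\<close> both solve the inverse problem, with Riccati solutions \<open>P\<close> and \<open>P'\<close>. Both
  are symmetric and \<open>transpose B\<close> annihilates \<open>G = P - P'\<close>, so the quadratic terms agree and \<open>G\<close>
  satisfies a Lyapunov differential equation with constant inhomogeneity \<open>Q - Qbar\<close>. Its derivative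
  \<open>H\<close> satisfies the homogeneous equation; the common kernel of all \<open>H t\<close> is \<open>A\<close>-invariant and
  contains the range of \<open>B\<close>, so controllability forces \<open>H = 0\<close>, and \<open>G\<close> witnesses
  \<open>Q - Qbar \<in> S_space A B\<close>.

  Hence \<open>trace (Q ** Xopt) = trace (Qbar ** Xopt) \<le> 0\<close>, the bound because \<open>X = 0\<close> is feasible. Since
  all matrices are positive semidefinite, \<open>Q\<close> and \<open>Qbar\<close> annihilate the eigenvectors of \<open>Xopt\<close> for
  its nonzero eigenvalues, so that \<open>Q - Qbar \<in> T_space e l V \<inter> S_space A B = {0}\<close>.\<close>

section \<open>Uniqueness for differential equations of linear growth\<close>

text \<open>A Gronwall argument run from \<open>s\<close> in both time directions: the weight
  \<open>exp (- 2 * L * u)\<close> makes \<open>z u \<bullet> z u\<close> nonincreasing to the right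
  of \<open>s\<close>, and \<open>exp (2 * L * u)\<close> makes it nondecreasing to the left. Both
  directions matter: a Riccati solution is prescribed at \<open>T\<close>, a controlled trajectory
  at \<open>0\<close>.\<close>

lemma linear_growth_zero:
  fixes z :: "real \<Rightarrow> 'a::real_inner"
  assumes d: "\<And>t. t \<in> {a..b} \<Longrightarrow> (z has_vector_derivative z' t) (at t within {a..b})"
    and L: "\<And>t. t \<in> {a..b} \<Longrightarrow> norm (z' t) \<le> L * norm (z t)"
    and s: "s \<in> {a..b}" "z s = 0" and t: "t \<in> {a..b}"
  shows "z t = 0"
proof -
  define g where "g c u = (z u \<bullet> z u) * exp (c * u)" for c u :: real
  define g' where "g' c u = (2 * (z u \<bullet> z' u) + c * (z u \<bullet> z u)) * exp (c * u)" for c u :: real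
  have dg: "(g c has_derivative (\<lambda>h. g' c u * h)) (at u within {p..q})"
    if "p \<le> u" "u \<le> q" "{p..q} \<subseteq> {a..b}" for c u p q
  proof -
    have "(z has_derivative (\<lambda>h. h *\<^sub>R z' u)) (at u within {p..q})"
      using d[of u] that unfolding has_vector_derivative_def
      by (auto intro: has_derivative_subset)
    then show ?thesis
      unfolding g_def g'_def
      by (auto intro!: derivative_eq_intros simp: fun_eq_iff algebra_simps inner_commute)
  qed
  have bnd: "\<bar>z u \<bullet> z' u\<bar> \<le> L * (z u \<bullet> z u)" if "u \<in> {a..b}" for u
  proof -
    have "\<bar>z u \<bullet> z' u\<bar> \<le> norm (z u) * norm (z' u)" by (rule Cauchy_Schwarz_ineq2)
    also have "\<dots> \<le> norm (z u) * (L * norm (z u))"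
      by (intro mult_left_mono L that) simp
    finally show ?thesis by (simp add: dot_square_norm power2_eq_square mult_ac)
  qed
  have "z t \<bullet> z t \<le> 0"
  proof (cases "s \<le> t")
    case True
    let ?c = "- 2 * L"
    obtain u where u: "u \<in> {s..t}" "g ?c t - g ?c s = g' ?c u * (t - s)"
      using mvt_very_simple[OF True, of "g ?c" "\<lambda>u h. g' ?c u * h"] dg s t by auto
    have "u \<in> {a..b}" using u s t by auto
    then have "g' ?c u \<le> 0"
      unfolding g'_def using bnd[of u] by (auto intro!: mult_nonpos_nonneg)
    then have "g ?c t \<le> g ?c s"
      using u True by (smt (verit) mult_nonpos_nonneg)
    then show ?thesis using s by (simp add: g_def mult_le_0_iff not_le[symmetric])
  next
    case False
    then have le: "t \<le> s" by simp
    let ?c = "2 * L"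
    obtain u where u: "u \<in> {t..s}" "g ?c s - g ?c t = g' ?c u * (s - t)"
      using mvt_very_simple[OF le, of "g ?c" "\<lambda>u h. g' ?c u * h"] dg s t by auto
    have "u \<in> {a..b}" using u s t by auto
    then have "g' ?c u \<ge> 0"
      unfolding g'_def using bnd[of u] by auto
    then have "g ?c t \<le> g ?c s"
      using u le by (smt (verit) mult_nonneg_nonneg)
    then show ?thesis using s by (simp add: g_def mult_le_0_iff not_le[symmetric])
  qed
  then show ?thesis by (metis inner_gt_zero_iff not_le)
qed

lemma bounded_bilinear_matrix_mult:
  "bounded_bilinear ((**) :: real^'n^'m \<Rightarrow> real^'k^'n \<Rightarrow> real^'k^'m)"
  unfolding bilinear_conv_bounded_bilinear[symmetric] bilinear_def
  by (auto intro!: linearI simp: matrix_matrix_mult_def vec_eq_iff sum_distrib_left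
      algebra_simps sum.distrib)

lemma bounded_bilinear_matrix_vector_mult:
  "bounded_bilinear ((*v) :: real^'n^'m \<Rightarrow> real^'n \<Rightarrow> real^'m)"
  unfolding bilinear_conv_bounded_bilinear[symmetric] bilinear_def
  by (auto intro!: linearI simp: matrix_vector_right_distrib matrix_vector_mult_scaleR
      matrix_vector_mult_add_rdistrib scaleR_matrix_vector_assoc)

lemmas bounded_linear_matrix_mult_left =
  bounded_bilinear.bounded_linear_left[OF bounded_bilinear_matrix_mult]
lemmas bounded_linear_matrix_mult_right =
  bounded_bilinear.bounded_linear_right[OF bounded_bilinear_matrix_mult]

lemma bounded_linear_transpose: "bounded_linear (transpose :: real^'n^'m \<Rightarrow> real^'m^'n)"
  unfolding linear_conv_bounded_linear[symmetric]
  by (rule linearI) (auto simp: transpose_def vec_eq_iff)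

section \<open>Symmetry of Riccati solutions\<close>

text \<open>For symmetric \<open>Q\<close> and \<open>F\<close> the transpose of \<open>P\<close>
  solves the same terminal value problem. The difference \<open>D\<close> of the two vanishes at
  \<open>T\<close> and has linear growth, hence is zero.\<close>

lemma riccati_solution_sym:
  fixes A :: "real^'n^'n" and B :: "real^'m^'n"
  assumes sol: "riccati_solution A B T Q F P" and Q: "Q \<in> sym_matrices" and F: "F \<in> sym_matrices"
    and t: "t \<in> {0..T}"
  shows "P t \<in> sym_matrices"
proof -
  define M where "M = B ** transpose B"
  define D where "D s = P s - transpose (P s)" for s
  \<comment> \<open>Inserting the mixed product \<open>transpose (P s) ** M ** P s\<close> makes the
    difference of the two quadratic terms linear in \<open>D s\<close>.\<close>
  define D' where "D' s = - (D s ** A + transpose A ** D s - (D s ** M ** P s + transpose (P s) ** M ** D s))" for s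
  have trM: "transpose M = M" by (simp add: M_def matrix_transpose_mul)
  have dP: "(P has_vector_derivative - (P s ** A + transpose A ** P s - P s ** M ** P s + Q)) (at s within {0..T})"
    if "s \<in> {0..T}" for s
    using sol that by (simp add: riccati_solution_def M_def matrix_mul_assoc)
  have dD: "(D has_vector_derivative D' s) (at s within {0..T})" if s: "s \<in> {0..T}" for s
  proof -
    have "(D has_vector_derivative
      - (P s ** A + transpose A ** P s - P s ** M ** P s + Q)
      - transpose (- (P s ** A + transpose A ** P s - P s ** M ** P s + Q))) (at s within {0..T})"
      unfolding D_def
      by (intro has_vector_derivative_diff dP s
          bounded_linear.has_vector_derivative[OF bounded_linear_transpose])
    moreover have "transpose (- (P s ** A + transpose A ** P s - P s ** M ** P s + Q))
      = - (transpose A ** transpose (P s) + transpose (P s) ** A - transpose (P s) ** M ** transpose (P s) + Q)"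
      using Q trM
      by (simp add: bounded_linear_transpose[THEN bounded_linear.linear, THEN linear_add]
          bounded_linear_transpose[THEN bounded_linear.linear, THEN linear_diff]
          bounded_linear_transpose[THEN bounded_linear.linear, THEN linear_neg]
          matrix_transpose_mul matrix_mul_assoc sym_matrices_def)
    moreover have "- (P s ** A + transpose A ** P s - P s ** M ** P s + Q)
      - (- (transpose A ** transpose (P s) + transpose (P s) ** A - transpose (P s) ** M ** transpose (P s) + Q)) = D' s"
      unfolding D'_def D_def
      by (simp add: bounded_bilinear.diff_left[OF bounded_bilinear_matrix_mult]
          bounded_bilinear.diff_right[OF bounded_bilinear_matrix_mult] algebra_simps)
    ultimately show ?thesis by simp
  qed
  \<comment> \<open>The coefficients of \<open>D s\<close> contain \<open>P s\<close>; compactness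
    of the horizon bounds them, so that one constant \<open>L\<close> serves all times.\<close>
  have "continuous_on {0..T} P"
    using dP by (metis continuous_on_eq_continuous_within has_vector_derivative_continuous)
  then have "bounded (P ` {0..T})"
    by (intro compact_imp_bounded compact_continuous_image) auto
  then obtain k where k: "\<And>s. s \<in> {0..T} \<Longrightarrow> norm (P s) \<le> k" unfolding bounded_iff by blast
  obtain C1 where C1: "C1 > 0" "\<And>X Y. norm ((X :: real^'n^'n) ** (Y :: real^'n^'n)) \<le> norm X * norm Y * C1"
    using bounded_bilinear.pos_bounded[OF bounded_bilinear_matrix_mult] by blast
  obtain C2 where C2: "C2 > 0" "\<And>X. norm (transpose (X :: real^'n^'n)) \<le> norm X * C2"
    using bounded_linear.pos_bounded[OF bounded_linear_transpose] by blast
  define L where "L = norm A * C1 + norm (transpose A) * C1 + norm M * k * C1 * C1 + C2 * k * norm M * C1 * C1"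
  have "norm (D' s) \<le> L * norm (D s)" if s: "s \<in> {0..T}" for s
  proof -
    have "norm (D s ** M ** P s) \<le> norm (D s) * norm M * C1 * norm (P s) * C1"
      using C1(1) by (intro order_trans[OF C1(2)] mult_right_mono C1(2)) auto
    also have "\<dots> \<le> norm (D s) * norm M * C1 * k * C1"
      using C1(1) k[OF s] by (intro mult_right_mono mult_left_mono) auto
    finally have 1: "norm (D s ** M ** P s) \<le> norm (D s) * norm M * C1 * k * C1" .
    have "norm (transpose (P s) ** M ** D s) \<le> norm (transpose (P s)) * norm M * C1 * norm (D s) * C1"
      using C1(1) by (intro order_trans[OF C1(2)] mult_right_mono C1(2)) auto
    also have "norm (transpose (P s)) \<le> k * C2"
      using C2 k[OF s] by (meson mult_right_mono order_trans less_imp_le)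
    finally have 2: "norm (transpose (P s) ** M ** D s) \<le> k * C2 * norm M * C1 * norm (D s) * C1"
      using C1(1) by (simp add: mult_right_mono)
    have "norm (D' s) \<le> norm (D s ** A) + norm (transpose A ** D s)
       + (norm (D s ** M ** P s) + norm (transpose (P s) ** M ** D s))"
      unfolding D'_def norm_minus_cancel
      by (intro order_trans[OF norm_triangle_ineq4] add_mono norm_triangle_ineq)
    also have "\<dots> \<le> norm (D s) * norm A * C1 + norm (transpose A) * norm (D s) * C1
       + (norm (D s) * norm M * C1 * k * C1 + k * C2 * norm M * C1 * norm (D s) * C1)"
      by (intro add_mono C1(2) 1 2)
    also have "\<dots> = L * norm (D s)" by (simp add: L_def algebra_simps)
    finally show ?thesis .
  qed
  moreover have "D T = 0" "T \<in> {0..T}"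
    using sol F t by (auto simp: D_def riccati_solution_def sym_matrices_def)
  ultimately have "D t = 0" using linear_growth_zero[of 0 T D D' L T t] dD t by blast
  then show ?thesis by (simp add: D_def sym_matrices_def)
qed

section \<open>Invariant subspaces of a controllable pair\<close>

text \<open>A trajectory starting at \<open>0\<close> never leaves the subspace: its component in a complement
  satisfies a homogeneous linear differential equation.\<close>

lemma controllable_invariant_subspace:
  fixes A :: "real^'n^'n" and B :: "real^'m^'n"
  assumes c: "controllable A B" and N: "subspace N"
    and NB: "\<And>u. B *v u \<in> N" and NA: "\<And>x. x \<in> N \<Longrightarrow> A *v x \<in> N"
  shows "x \<in> N"
proof -
  obtain B1 where B1: "B1 \<subseteq> N" "independent B1" "span B1 = N"
    by (metis N basis_exists span_subspace)
  obtain C where C: "B1 \<subseteq> C" "independent C" "UNIV \<subseteq> span C"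
    by (rule maximal_independent_subset_extend[OF subset_UNIV B1(2)])
  \<comment> \<open>\<open>f\<close> is the projection with kernel \<open>N\<close> onto the span of
    the added basis vectors \<open>C - B1\<close>, so \<open>f x = 0\<close> will give
    \<open>x \<in> N\<close>.\<close>
  obtain f where f: "linear f" "\<And>y. y \<in> C \<Longrightarrow> f y = (if y \<in> B1 then 0 else y)"
    using linear_independent_extend[OF C(2), of "\<lambda>y. if y \<in> B1 then 0 else y"] by auto
  have f0: "f y = 0" if "y \<in> N" for y
  proof (rule linear_eq_on[OF f(1) linear_zero])
    show "y \<in> span B1" using that B1(3) by simp
    show "f b = 0" if "b \<in> B1" for b using that C(1) f(2) by auto
  qed
  have fN: "y - f y \<in> N" for y
  proof -
    have "y \<in> span C" using C(3) by blast
    then show ?thesis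
    proof (induction rule: span_induct_alt)
      case base
      then show ?case using N f(1) by (simp add: linear_0 subspace_0)
    next
      case (step k y z)
      have "y - f y \<in> N" using f(2)[OF step(1)] B1 N by (auto simp: subspace_0)
      then have "k *\<^sub>R (y - f y) + (z - f z) \<in> N"
        using step(2) N by (simp add: subspace_add subspace_scale)
      then show ?case
        using f(1) by (simp add: linear_add linear_scale algebra_simps)
    qed
  qed
  have bf: "bounded_linear f" using f(1) by (simp add: linear_conv_bounded_linear)
  \<comment> \<open>Modulo \<open>N\<close> both the control term and the image under
    \<open>A\<close> of the part of \<open>y\<close> in \<open>N\<close> disappear, so
    \<open>f\<close> of a trajectory obeys an equation free of \<open>u\<close>.\<close>
  have fA: "f (A *v y + B *v u) = f (A *v f y)" for y u
  proof -
    have "f (A *v (y - f y) + B *v u) = 0"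
      by (intro f0 subspace_add[OF N] NA NB fN)
    then show ?thesis
      using f(1) by (simp add: linear_add linear_diff matrix_vector_mult_diff_distrib algebra_simps)
  qed
  have "bounded_linear (\<lambda>y. f (A *v y))"
    by (rule bounded_linear_compose[OF bf matrix_vector_mul_bounded_linear])
  then obtain L where L: "\<And>y. norm (f (A *v y)) \<le> norm y * L"
    using bounded_linear.bounded by blast
  obtain \<tau> u y where tau: "\<tau> > 0" "y 0 = 0" "y \<tau> = x" and
    dy: "\<And>t. t\<in>{0..\<tau>} \<Longrightarrow> (y has_vector_derivative (A *v y t + B *v u t)) (at t within {0..\<tau>})"
    using c unfolding controllable_def by blast
  have "f (y \<tau>) = 0"
  proof (rule linear_growth_zero[of 0 \<tau> "\<lambda>t. f (y t)" "\<lambda>t. f (A *v f (y t))" L 0])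
    fix t assume "t \<in> {0..\<tau>}"
    from bounded_linear.has_vector_derivative[OF bf dy[OF this]]
    show "((\<lambda>t. f (y t)) has_vector_derivative f (A *v f (y t))) (at t within {0..\<tau>})"
      by (simp add: fA)
  qed (use tau L f(1) in \<open>auto simp: linear_0 mult.commute\<close>)
  then show ?thesis using fN[of x] tau by simp
qed

section \<open>Differences of inverse LQ solutions\<close>

lemma inverse_LQ_solutions_diff:
  fixes A :: "real^'n^'n" and B :: "real^'m^'n"
  assumes c: "controllable A B" and T: "T > 0"
    and Q1: "Q1 \<in> inverse_LQ_solutions A B T K" and Q2: "Q2 \<in> inverse_LQ_solutions A B T K"
  shows "Q1 - Q2 \<in> S_space A B"
proof -
  obtain F1 P1 where 1: "F1 \<in> psd_cone" "riccati_solution A B T Q1 F1 P1"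
      "\<And>t. t\<in>{0..T} \<Longrightarrow> K t = - (transpose B ** P1 t)"
    using Q1 by (auto simp: inverse_LQ_solutions_def is_DRE_def)
  obtain F2 P2 where 2: "F2 \<in> psd_cone" "riccati_solution A B T Q2 F2 P2"
      "\<And>t. t\<in>{0..T} \<Longrightarrow> K t = - (transpose B ** P2 t)"
    using Q2 by (auto simp: inverse_LQ_solutions_def is_DRE_def)
  have symQ: "Q1 \<in> sym_matrices" "Q2 \<in> sym_matrices"
    using Q1 Q2 by (auto simp: inverse_LQ_solutions_def psd_cone_def)
  have symP: "P1 t \<in> sym_matrices" "P2 t \<in> sym_matrices" if "t \<in> {0..T}" for t
    using riccati_solution_sym[OF 1(2) symQ(1) _ that] riccati_solution_sym[OF 2(2) symQ(2) _ that] 1(1) 2(1)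
    by (auto simp: psd_cone_def)
  note trdiff = linear_diff[OF bounded_linear.linear[OF bounded_linear_transpose]]
  define G where "G t = P1 t - P2 t" for t
  define H where "H t = - (G t ** A + transpose A ** G t + (Q1 - Q2))" for t
  have symG: "transpose (G t) = G t" if "t \<in> {0..T}" for t
    using symP[OF that] by (simp add: G_def sym_matrices_def trdiff)
  have BP: "transpose B ** P1 t = transpose B ** P2 t" if "t \<in> {0..T}" for t
    using 1(3)[OF that] 2(3)[OF that] by simp
  have BG: "transpose B ** G t = 0" if "t \<in> {0..T}" for t
    using BP[OF that]
    by (simp add: G_def bounded_bilinear.diff_right[OF bounded_bilinear_matrix_mult])
  have GB: "G t ** B = 0" if "t \<in> {0..T}" for t
  proof -
    have "transpose (transpose B ** G t) = G t ** B"
      using symG[OF that] by (simp add: matrix_transpose_mul)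
    then show ?thesis using BG[OF that] by (simp add: transpose_def vec_eq_iff)
  qed
  \<comment> \<open>Equal feedbacks give equality of the right factors
    \<open>transpose B ** P\<close>; symmetry transfers it to the left factors
    \<open>P ** B\<close>.\<close>
  have PP: "P1 t ** B ** transpose B ** P1 t = P2 t ** B ** transpose B ** P2 t" if t: "t \<in> {0..T}" for t
  proof -
    have "P1 t ** B = P2 t ** B"
      using GB[OF t] by (simp add: G_def bounded_bilinear.diff_left[OF bounded_bilinear_matrix_mult])
    then show ?thesis using BP[OF t] by (simp add: matrix_mul_assoc[symmetric])
  qed
  have dG: "(G has_vector_derivative H t) (at t within {0..T})" if t: "t \<in> {0..T}" for t
  proof -
    have "(G has_vector_derivative
          - (P1 t ** A + transpose A ** P1 t - P1 t ** B ** transpose B ** P1 t + Q1)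
        - - (P2 t ** A + transpose A ** P2 t - P2 t ** B ** transpose B ** P2 t + Q2)) (at t within {0..T})"
      unfolding G_def using 1(2) 2(2) t
      by (intro has_vector_derivative_diff) (auto simp: riccati_solution_def)
    then show ?thesis
      using PP[OF t] by (simp add: H_def G_def bounded_bilinear.diff_left[OF bounded_bilinear_matrix_mult]
          bounded_bilinear.diff_right[OF bounded_bilinear_matrix_mult] algebra_simps)
  qed
  have dH: "(H has_vector_derivative - (H t ** A + transpose A ** H t)) (at t within {0..T})"
    if t: "t \<in> {0..T}" for t
    unfolding H_def[abs_def] using dG[OF t] unfolding H_def
    by (auto intro!: derivative_eq_intros
        bounded_linear.has_vector_derivative[OF bounded_linear_matrix_mult_left]
        bounded_linear.has_vector_derivative[OF bounded_linear_matrix_mult_right])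
  note bv = bounded_bilinear.bounded_linear_left[OF bounded_bilinear_matrix_vector_mult]
  \<comment> \<open>If a matrix curve annihilates a fixed vector throughout, so does its derivative;
    \<open>T > 0\<close> makes derivatives within the horizon unique, also at the end points. This
    serves \<open>G\<close> with the vectors \<open>B *v u\<close> and \<open>H\<close> with the
    vectors of \<open>N\<close>.\<close>
  have zero: "E' *v x = 0" if t: "t \<in> {0..T}" and E: "(E has_vector_derivative E') (at t within {0..T})"
    and E0: "\<And>s. s \<in> {0..T} \<Longrightarrow> E s *v x = 0" for E :: "real \<Rightarrow> real^'n^'n" and E' t x
  proof -
    have "((\<lambda>s. E s *v x) has_vector_derivative E' *v x) (at t within {0..T})"
      by (rule bounded_linear.has_vector_derivative[OF bv E])
    moreover have "((\<lambda>s. E s *v x) has_vector_derivative 0) (at t within {0..T})"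
      by (rule has_vector_derivative_transform[OF t _ has_vector_derivative_const[of 0]]) (simp add: E0)
    ultimately show ?thesis
      using vector_derivative_unique_within_closed_interval[of 0 T t] T t by (metis cbox_interval)
  qed
  define N where "N = {x. \<forall>t\<in>{0..T}. H t *v x = 0}"
  have "x \<in> N" for x
  proof (rule controllable_invariant_subspace[OF c])
    show "subspace N"
      by (auto simp: N_def subspace_def matrix_vector_right_distrib matrix_vector_mult_scaleR)
    show "B *v u \<in> N" for u
    proof -
      have "H t *v (B *v u) = 0" if t: "t \<in> {0..T}" for t
        by (rule zero[OF t dG[OF t]]) (simp add: matrix_vector_mul_assoc GB)
      then show ?thesis by (simp add: N_def)
    qed

    \<comment> \<open>Differentiating \<open>H t *v x = 0\<close> produces two terms; the one in
      which \<open>H t\<close> acts directly on \<open>x\<close> already vanishes.\<close>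
    show "A *v x \<in> N" if "x \<in> N" for x
    proof -
      have "H t *v (A *v x) = 0" if t: "t \<in> {0..T}" for t
      proof -
        have "- (H t ** A + transpose A ** H t) *v x = 0"
          using \<open>x \<in> N\<close> by (intro zero[OF t dH[OF t]]) (auto simp: N_def)
        then have "(H t ** A + transpose A ** H t) *v x = 0"
          unfolding linear_neg[OF bounded_linear.linear[OF bv]] by (metis neg_equal_0_iff_equal)
        moreover have "(transpose A ** H t) *v x = 0"
          using \<open>x \<in> N\<close> t by (auto simp: N_def matrix_vector_mul_assoc[symmetric])
        ultimately show ?thesis
          by (simp add: matrix_vector_mult_add_rdistrib matrix_vector_mul_assoc)
      qed
      then show ?thesis by (simp add: N_def)
    qed
  qed
  \<comment> \<open>Any instant of the horizon would do: where \<open>H\<close> vanishes, its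
    definition is the algebraic Lyapunov equation with \<open>G 0\<close> as
    \<open>dP\<close>.\<close>
  then have "H 0 = 0" using T by (simp add: N_def matrix_eq)
  then have "transpose A ** G 0 + G 0 ** A + (Q1 - Q2) = 0"
    by (simp add: H_def algebra_simps)
  moreover have "G 0 \<in> sym_matrices" "transpose B ** G 0 = 0" "Q1 - Q2 \<in> sym_matrices"
    using symG BG T symQ by (auto simp: sym_matrices_def trdiff)
  ultimately show ?thesis by (auto simp: S_space_def)
qed

section \<open>Semidefinite matrices in eigenvector coordinates\<close>

lemma inner_axis_matrix: "axis i 1 \<bullet> (M *v axis j 1) = M $ i $ j" for M :: "real^'n^'m"
  by (simp add: inner_axis' matrix_vector_mult_basis column_def)

lemma psd_congruence:
  fixes Q V :: "real^'n^'n"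
  assumes "Q \<in> psd_cone"
  shows "transpose V ** Q ** V \<in> psd_cone"
proof -
  have "x \<bullet> ((transpose V ** Q ** V) *v x) = (V *v x) \<bullet> (Q *v (V *v x))" for x
    by (metis dot_lmul_matrix matrix_vector_mul_assoc vector_transpose_matrix)
  then show ?thesis
    using assms by (auto simp: psd_cone_def sym_matrices_def matrix_transpose_mul matrix_mul_assoc)
qed

lemma psd_diag_nonneg:
  fixes M :: "real^'n^'n"
  assumes "M \<in> psd_cone"
  shows "0 \<le> M $ i $ i"
proof -
  have "0 \<le> axis i 1 \<bullet> (M *v axis i 1)" using assms by (simp add: psd_cone_def)
  then show ?thesis by (simp add: inner_axis_matrix)
qed

text \<open>A zero diagonal entry makes a basis vector isotropic, and isotropic vectors of a
  semidefinite matrix lie in its kernel. One scalar equation thus clears a whole column.\<close>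

lemma psd_diag_zero:
  fixes M :: "real^'n^'n"
  assumes M: "M \<in> psd_cone" and i: "M $ i $ i = 0"
  shows "M $ k $ i = 0"
proof -
  have "M *v axis i 1 = 0"
    by (rule psd_null_vector[OF M]) (simp add: inner_axis_matrix i)
  then show ?thesis by (metis inner_axis_matrix inner_zero_right)
qed

lemma rank_le_card_nonzero_columns:
  fixes M :: "real^'n^'m"
  assumes "\<And>i. i \<notin> I \<Longrightarrow> column i M = 0"
  shows "rank M \<le> card I"
proof -
  have "columns M \<subseteq> insert 0 ((\<lambda>i. column i M) ` I)"
    using assms by (auto simp: columns_def)
  also have "\<dots> \<subseteq> span ((\<lambda>i. column i M) ` I)"
    by (auto simp: span_zero intro: span_base)
  finally have "dim (columns M) \<le> card ((\<lambda>i. column i M) ` I)"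
    by (rule dim_le_card) simp
  also have "\<dots> \<le> card I" by (rule card_image_le) simp
  finally show ?thesis by (simp add: column_rank_def)
qed

text \<open>A zero among the leading entries would leave fewer than \<open>l\<close> columns that
  can be nonzero. The diagonal form alone does not say that the listed eigenvalues are nonzero; the
  rank does.\<close>

lemma rank_leading_diag_full:
  fixes e :: "'n::finite \<Rightarrow> nat"
  assumes e: "bij_betw e UNIV {1..CARD('n)}"
    and l: "l \<le> rank (leading_diag e l ev :: real^'n^'n)" and i: "e i \<le> l"
  shows "ev (e i) \<noteq> 0"
proof
  assume 0: "ev (e i) = 0"
  let ?I = "{j. e j \<le> l} - {i}"
  have "l \<le> card ?I"
    by (rule order_trans[OF l rank_le_card_nonzero_columns])
      (use 0 in \<open>auto simp: leading_diag_def column_def vec_eq_iff\<close>)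
  also have "\<dots> < card {j. e j \<le> l}" using i by (intro psubset_card_mono) auto
  also have "\<dots> = card (e ` {j. e j \<le> l})"
    by (metis bij_betw_def card_image e inj_on_subset subset_UNIV)
  also have "\<dots> \<le> card {1..l}"
    using e by (intro card_mono) (auto simp: bij_betw_def)
  finally show False by simp
qed

text \<open>Symmetry turns the vanishing leading columns into vanishing leading rows, so only the
  trailing block survives in the coordinates of \<open>V\<close>.\<close>

lemma T_space_memI:
  fixes D V :: "real^'n^'n"
  assumes e: "bij_betw e UNIV {1..CARD('n)}" and V: "orthogonal_matrix V"
    and D: "D \<in> sym_matrices"
    and M: "\<And>i k. e i \<le> l \<Longrightarrow> (transpose V ** D ** V) $ k $ i = 0"
  shows "D \<in> T_space e l V"
proof -
  define M where "M = transpose V ** D ** V"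
  \<comment> \<open>Adding \<open>l\<close> undoes the index shift of \<open>trailing_block\<close>;
    entries of \<open>W\<close> outside the block are never read.\<close>
  define W where "W p q = M $ inv e (p + l) $ inv e (q + l)" for p q
  have "transpose M = M"
    using D by (simp add: M_def matrix_transpose_mul sym_matrices_def matrix_mul_assoc)
  then have symM: "M $ i $ j = M $ j $ i" for i j
    by (metis (no_types, lifting) transpose_def vec_lambda_beta)
  have MM: "M $ k $ i = 0" "M $ i $ k = 0" if "e i \<le> l" for i k
    using M[OF that, folded M_def] symM by metis+
  have inv: "inv e (e i) = i" for i
    using e by (simp add: bij_betw_def)
  have "trailing_block e l W = M"
    using MM by (auto simp: trailing_block_def W_def vec_eq_iff inv not_less)
  moreover have "V ** M ** transpose V = D"
  proof -
    have "V ** M ** transpose V = (V ** transpose V) ** D ** (V ** transpose V)"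
      by (simp add: M_def matrix_mul_assoc)
    then show ?thesis using V by (simp add: orthogonal_matrix_def)
  qed
  moreover have "W p q = W q p" for p q by (simp add: W_def symM)
  ultimately show ?thesis unfolding T_space_def by blast
qed

section \<open>Uniqueness from the optimal \<open>Xopt\<close>\<close>

theorem proposition14:
  fixes A :: "real^'n^'n" and B :: "real^'m^'n" and T :: real
    and K :: "real \<Rightarrow> real^'n^'m"
    and Qbar Xopt V :: "real^'n^'n"
    and dQ :: "nat \<Rightarrow> real^'n^'n" and r :: nat
    and e :: "'n \<Rightarrow> nat" and ev :: "nat \<Rightarrow> real" and l :: nat
  assumes "controllable A B"
    and "rank B = CARD('m)"
    and "T > 0"
    and "Qbar \<in> psd_boundary"
    and "Qbar \<in> inverse_LQ_solutions A B T K"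
    and "inj_on dQ {1..r}" and "independent (dQ ` {1..r})"
    and "span (dQ ` {1..r}) = S_space A B"
    and "is_arg_min (\<lambda>X. trace (Qbar ** X))
           (\<lambda>X. X \<in> psd_cone \<and> (\<forall>i\<in>{1..r}. trace (dQ i ** X) = 0)) Xopt"
    and "Xopt \<noteq> 0"
    and "bij_betw e UNIV {1..CARD('n)}"
    and "orthogonal_matrix V"
    and "l = rank Xopt"
    and "Xopt = V ** leading_diag e l ev ** transpose V"
    and "T_space e l V \<inter> S_space A B = {0}"
  shows "inverse_LQ_solutions A B T K = {Qbar}"
proof -
  have psd: "Q \<in> psd_cone" if "Q \<in> inverse_LQ_solutions A B T K" for Q
    using that by (simp add: inverse_LQ_solutions_def)
  note Xopt = assms(9)[unfolded is_arg_min_def]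
  have diff: "Q - Qbar \<in> S_space A B" if "Q \<in> inverse_LQ_solutions A B T K" for Q
    by (rule inverse_LQ_solutions_diff[OF assms(1,3) that assms(5)])
  have "0 \<in> (psd_cone :: (real^'n^'n) set)"
    by (simp add: psd_cone_def sym_matrices_def transpose_def vec_eq_iff)
  then have opt: "trace (Qbar ** Xopt) \<le> 0"
    using Xopt by (force simp: trace_def not_less)
  \<comment> \<open>The constraints on \<open>Xopt\<close> concern the spanning matrices
    \<open>dQ i\<close>; linearity of the trace extends them to the whole subspace.\<close>
  have S_tr: "trace (D ** Xopt) = 0" if "D \<in> S_space A B" for D
  proof -
    have "linear (\<lambda>D. trace (D ** Xopt))"
      by (rule linearI)
        (simp_all add: bounded_bilinear.add_left[OF bounded_bilinear_matrix_mult]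
          bounded_bilinear.scaleR_left[OF bounded_bilinear_matrix_mult] trace_def
          sum.distrib sum_distrib_left)
    moreover have "D \<in> span (dQ ` {1..r})" using that assms(8) by simp
    ultimately show ?thesis
      using Xopt linear_eq_0_on_span[of "\<lambda>D. trace (D ** Xopt)" "dQ ` {1..r}" D] by auto
  qed
  define Lam where "Lam = (leading_diag e l ev :: real^'n^'n)"
  have VV: "transpose V ** V = mat 1" using assms(12) by (simp add: orthogonal_matrix_def)
  have XL: "transpose V ** Xopt ** V = Lam"
  proof -
    have "transpose V ** Xopt ** V = (transpose V ** V) ** Lam ** (transpose V ** V)"
      by (simp add: assms(14) Lam_def matrix_mul_assoc)
    then show ?thesis by (simp add: VV)
  qed
  \<comment> \<open>Multiplication does not raise the rank, so \<open>l \<le> rank Lam\<close> and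
    the leading entries are nonzero; semidefiniteness of \<open>Lam\<close> then makes them
    positive.\<close>
  have "rank Xopt \<le> rank Lam"
    using rank_mul_le_left[of "V ** Lam" "transpose V"] rank_mul_le_right[of V Lam]
    by (simp add: assms(14) Lam_def)
  then have nz: "ev (e i) \<noteq> 0" if "e i \<le> l" for i
    using rank_leading_diag_full[OF assms(11) _ that] assms(13) by (simp add: Lam_def)
  have LamP: "Lam \<in> psd_cone"
    unfolding XL[symmetric] using Xopt by (simp add: psd_congruence)
  have pos: "ev (e i) > 0" if "e i \<le> l" for i
  proof -
    have "0 \<le> Lam $ i $ i"
      by (rule psd_diag_nonneg[OF LamP])
    then show ?thesis using nz[OF that] that by (simp add: Lam_def leading_diag_def)
  qed
  \<comment> \<open>In the coordinates of \<open>V\<close> the trace is a sum of products of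
    nonnegative diagonal entries. As it is at most zero, every product vanishes, and a positive
    entry of \<open>Lam\<close> forces the matching entry of \<open>M\<close> to be zero.\<close>
  have zero: "(transpose V ** Q ** V) $ k $ i = 0"
    if Q: "Q \<in> inverse_LQ_solutions A B T K" and i: "e i \<le> l" for Q i k
  proof -
    define M where "M = transpose V ** Q ** V"
    have M: "M \<in> psd_cone" unfolding M_def by (intro psd_congruence psd Q)
    have M0: "0 \<le> M $ j $ j" for j
      by (rule psd_diag_nonneg[OF M])
    have "trace (Q ** Xopt) = trace (Qbar ** Xopt)"
      using S_tr[OF diff[OF Q]]
      by (simp add: bounded_bilinear.diff_left[OF bounded_bilinear_matrix_mult] trace_sub)
    moreover have "trace (Q ** Xopt) = trace (M ** Lam)"
      using trace_mul_sym[of "Q ** V ** Lam" "transpose V"]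
      by (simp add: M_def assms(14) Lam_def matrix_mul_assoc)
    moreover have "trace (M ** Lam) = (\<Sum>j\<in>UNIV. M $ j $ j * Lam $ j $ j)"
    proof -
      have "(\<Sum>k\<in>UNIV. M $ j $ k * Lam $ k $ j) = M $ j $ j * Lam $ j $ j" for j
        by (subst sum.remove[of _ j]) (auto simp: Lam_def leading_diag_def intro!: sum.neutral)
      then show ?thesis by (simp add: trace_def matrix_matrix_mult_def)
    qed
    ultimately have "(\<Sum>j\<in>UNIV. M $ j $ j * Lam $ j $ j) \<le> 0" using opt by simp
    moreover have nonneg: "0 \<le> M $ j $ j * Lam $ j $ j" for j
      using M0[of j] pos[of j] by (auto simp: Lam_def leading_diag_def)
    ultimately have "M $ i $ i * Lam $ i $ i = 0"
      by (smt (verit) UNIV_I finite sum_nonneg sum_nonneg_eq_0_iff)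
    then have "M $ i $ i = 0" using pos[OF i] i by (simp add: Lam_def leading_diag_def)
    then show ?thesis using psd_diag_zero[OF M] by (simp add: M_def)
  qed
  have "Q = Qbar" if Q: "Q \<in> inverse_LQ_solutions A B T K" for Q
  proof -
    have "Q - Qbar \<in> T_space e l V"
    proof (rule T_space_memI[OF assms(11,12)])
      show "Q - Qbar \<in> sym_matrices" using diff[OF Q] by (simp add: S_space_def)
      show "(transpose V ** (Q - Qbar) ** V) $ k $ i = 0" if "e i \<le> l" for i k
        using zero[OF Q that] zero[OF assms(5) that]
        by (simp add: bounded_bilinear.diff_left[OF bounded_bilinear_matrix_mult]
            bounded_bilinear.diff_right[OF bounded_bilinear_matrix_mult])
    qed
    then have "Q - Qbar \<in> {0}" using diff[OF Q] assms(15) by blast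
    then show ?thesis by simp
  qed
  then show ?thesis using assms(5) by blast
qed

end
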